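(* Let $k\ge 0$ be an integer and let $a_0,a_1,\dots,a_{k+1}$ be positive real numbers. Then \[\frac{[a_0,\dots,a_k,a_{k+1}-i]+[a_0,\dots,a_k,a_{k+1}+i]}{2}=[a_0,a_1,\dots,a_k,a_{k+1},a_{k+1},a_k,\dots,a_1],\] \[\sqrt{[a_0,\dots,a_k,a_{k+1}-i]\cdot[a_0,\dots,a_k,a_{k+1}+i]}=[a_0,\overline{a_1,\dots,a_k,a_{k+1},a_{k+1},a_k,\dots,a_1,2a_0}],\] \[\frac{2}{\frac{1}{[a_0,\dots,a_k,a_{k+1}-i]}+\frac{1}{[a_0,\dots,a_k,a_{k+1}+i]}}=[a_0,a_1,\dots,a_k,a_{k+1},a_{k+1},a_k,\dots,a_1,a_0],\] \[\cot\left(\frac{\cot^{-1}[a_0,\dots,a_k,a_{k+1}-i]+\cot^{-1}[a_0,\dots,a_k,a_{k+1}+i]}{2}\right)=[\overline{a_0,a_1,\dots,a_k,a_{k+1},a_{k+1},a_k,\dots,a_1,a_0}],\] where $i$ is the imaginary unit.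
   Context: For (possibly complex) numbers $a_0,a_1,\dots$, the continued fraction $[a_0,a_1,\dots,a_n]$ denotes $a_0+\cfrac{1}{a_1+\cfrac{1}{\ddots+\cfrac{1}{a_n}}}$ (and $[a_0]=a_0$); an infinite continued fraction $[a_0,a_1,a_2,\dots]$ denotes the limit of the finite ones $[a_0,\dots,a_n]$ as $n\to\infty$. An overline denotes a block repeated infinitely often, e.g. $[a_0,\overline{b_1,\dots,b_m}]=[a_0,b_1,\dots,b_m,b_1,\dots,b_m,\dots]$. When $k=0$, the block "$a_k,\dots,a_1$" is empty. $\cot^{-1}$ denotes the (principal branch of the) inverse cotangent. *)

theory Defs
  imports "HOL-Analysis.Analysis" "HOL-Library.Stream"
begin

text \<open>The empty list does not denote a continued fraction; \<open>cfrac []\<close> is left unspecified.\<close>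

fun cfrac :: "'a::field list \<Rightarrow> 'a" where
  "cfrac [a] = a"
| "cfrac (a # b # xs) = a + 1 / cfrac (b # xs)"

text \<open>An equation \<open>L = [a\<^sub>0, a\<^sub>1, \<dots>]\<close> between a number and an infinite continued fraction
  asserts that the finite ones converge, and that their limit is \<open>L\<close>.\<close>

definition has_cfrac :: "'a::{field,topological_space} stream \<Rightarrow> 'a \<Rightarrow> bool" where
  "has_cfrac s L \<longleftrightarrow> (\<lambda>n. cfrac (stake (Suc n) s)) \<longlonglongrightarrow> L"

text \<open>The principal branch taking values in the strip \<open>0 < Re w < pi\<close> off the branch cuts.
  The other common convention, \<open>Arctan (1 / z)\<close>, agrees with it on \<open>Re z > 0\<close>.\<close>

definition Arccot :: "complex \<Rightarrow> complex" where
  "Arccot z = of_real (pi / 2) - Arctan z"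

lemma cot_Arccot:
  assumes "z \<noteq> \<i>" "z \<noteq> - \<i>"
  shows "cot (Arccot z) = z"
proof -
  have "z\<^sup>2 \<noteq> -1"
    using assms by (metis power2_eq_iff power2_i)
  then have "tan (Arctan z) = z"
    by (rule tan_Arctan)
  moreover have "cot (of_real (pi / 2) - w) = tan w" for w :: complex
    by (simp add: cot_def tan_def sin_diff cos_diff sin_of_real cos_of_real
        del: of_real_divide)
  ultimately show ?thesis
    by (simp add: Arccot_def)
qed

lemma Arccot_bounds:
  assumes "Re z = 0 \<Longrightarrow> \<bar>Im z\<bar> < 1"
  shows "0 < Re (Arccot z)" "Re (Arccot z) < pi"
  using Re_Arctan_bounds[OF assms] by (auto simp: Arccot_def)

end

theory Submission
  imports Defs
begin

text \<open>Let \<open>M = ((P, P'), (Q, Q'))\<close> be the matrix of \<open>[a\<^sub>0, \<dots>, a\<^sub>k\<^sub>+\<^sub>1]\<close>, the product of the symmetric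
  matrices \<open>((a\<^sub>j, 1), (1, 0))\<close>. The two complex continued fractions are
  \<open>(P \<mp> i P') / (Q \<mp> i Q')\<close>, so their sum and product are \<open>2 R / S\<close> and \<open>N / S\<close>, where
  \<open>((N, R), (R, S)) = M M\<^sup>T\<close> is the matrix of the palindrome \<open>[a\<^sub>0, \<dots>, a\<^sub>k\<^sub>+\<^sub>1, a\<^sub>k\<^sub>+\<^sub>1, \<dots>, a\<^sub>0]\<close>. The
  finite identities can be read off from this matrix; the periodic ones hold because
  both sides are the positive solution of the same quadratic equation, \<open>S x\<^sup>2 = N\<close> and
  \<open>R x\<^sup>2 + S x = N x + R\<close> respectively, the latter being the double angle formula for \<open>cot\<close>.\<close>

section \<open>Finite continued fractions and cyclic streams\<close>

lemma cfrac_Cons: "xs \<noteq> [] \<Longrightarrow> cfrac (x # xs) = x + 1 / cfrac xs"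
  by (cases xs) auto

lemma of_real_cfrac:
  "xs \<noteq> [] \<Longrightarrow> cfrac (map of_real xs) = (of_real (cfrac xs) :: 'a::{real_div_algebra,field})"
  by (induction xs rule: cfrac.induct) auto

lemma cfrac_append_append:
  "ys \<noteq> [] \<Longrightarrow> cfrac (xs @ ys) = cfrac (xs @ [cfrac ys])"
  by (induction xs) (auto simp: cfrac_Cons)

lemma cfrac_ge_hd:
  fixes xs :: "real list"
  assumes "xs \<noteq> []" "\<forall>x\<in>set xs. 0 < x"
  shows "hd xs \<le> cfrac xs"
  using assms
proof (induction xs rule: cfrac.induct)
  case (2 a b xs)
  then have "b \<le> cfrac (b # xs)" "0 < b" by auto
  then show ?case by simp
qed auto

lemma cfrac_pos:
  fixes xs :: "real list"
  assumes "xs \<noteq> []" "\<forall>x\<in>set xs. 0 < x"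
  shows "0 < cfrac xs"
  using cfrac_ge_hd[OF assms] assms by (cases xs) auto

text \<open>Coinduction over all \<open>xs\<close>, because the tail of a cycle is the cycle of the
  rotated list and rotation commutes with \<open>map f\<close>. Needed to carry periodic expansions
  from the reals to the complex numbers.\<close>

lemma smap_cycle: "xs \<noteq> [] \<Longrightarrow> smap f (cycle xs) = cycle (map f xs)"
proof (coinduction arbitrary: xs)
  case (Eq_stream xs)
  then have "map f (tl xs @ [hd xs]) = tl (map f xs) @ [hd (map f xs)]"
    by (cases xs) auto
  then have "stl (cycle (map f xs)) = cycle (map f (tl xs @ [hd xs]))"
    by (simp only: cycle.sel)
  moreover have "stl (smap f (cycle xs)) = smap f (cycle (tl xs @ [hd xs]))"
    by simp
  moreover have "shd (smap f (cycle xs)) = shd (cycle (map f xs))"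
    using Eq_stream by (simp add: hd_map)
  ultimately show ?case by blast
qed

section \<open>Continuant matrices\<close>

text \<open>For a nonempty list, column 1 holds numerator and denominator of its continued fraction,
  column 2 those of the list without its last entry, with the conventional 1/0 for a single
  entry.\<close>

fun cfmat :: "real list \<Rightarrow> real^2^2" where
  "cfmat [] = mat 1"
| "cfmat (x # xs) = (\<chi> i j. if i = 1 \<and> j = 1 then x else if i = j then 0 else 1) ** cfmat xs"

lemma cfmat_append: "cfmat (xs @ ys) = cfmat xs ** cfmat ys"
  by (induction xs) (auto simp: matrix_mul_assoc)

text \<open>The factors are symmetric, so transposing the product only reverses their order.\<close>

lemma transpose_cfmat: "transpose (cfmat xs) = cfmat (rev xs)"
proof (induction xs)
  case (Cons x xs)
  have "transpose (\<chi> i j. if i = 1 \<and> j = 1 then x else if i = j then 0 else 1) =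
      (\<chi> i j. if i = 1 \<and> j = 1 then x else if i = j then 0 else 1 :: real^2^2)"
    by (auto simp: transpose_def vec_eq_iff)
  with Cons show ?case
    by (simp add: matrix_transpose_mul cfmat_append)
qed (simp add: transpose_mat)

lemma cfmat_Cons_nth [simp]:
  "cfmat (x # xs) $ 1 $ j = x * cfmat xs $ 1 $ j + cfmat xs $ 2 $ j"
  "cfmat (x # xs) $ 2 $ j = cfmat xs $ 1 $ j"
  by (simp_all add: matrix_matrix_mult_def sum_2)

lemma cfmat_snoc_nth [simp]:
  "cfmat (xs @ [x]) $ i $ 1 = x * cfmat xs $ i $ 1 + cfmat xs $ i $ 2"
  "cfmat (xs @ [x]) $ i $ 2 = cfmat xs $ i $ 1"
  by (simp_all add: cfmat_append matrix_matrix_mult_def sum_2 mat_def)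

declare cfmat.simps(2) [simp del]

lemma cfmat_nonneg:
  assumes "\<forall>x\<in>set xs. 0 < x"
  shows "0 < cfmat xs $ 1 $ 1" "0 \<le> cfmat xs $ 1 $ 2" "0 \<le> cfmat xs $ 2 $ 1" "0 \<le> cfmat xs $ 2 $ 2"
  using assms by (induction xs) (auto simp: mat_def add_pos_nonneg)

lemma cfmat_pos:
  assumes "\<forall>x\<in>set xs. 0 < x" "xs \<noteq> []"
  shows "0 < cfmat xs $ 2 $ 1"
  using assms cfmat_nonneg(1)[of "tl xs"] by (cases xs) auto

text \<open>Both claims go through the induction together: for \<open>0 < x\<close> the map from
  \<open>f\<close> to \<open>x + 1 / f\<close> preserves the right half plane, and staying there
  keeps the denominators nonzero.\<close>

lemma cfrac_cfmat:
  fixes y :: complex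
  assumes "\<forall>x\<in>set xs. 0 < x" "0 < Re y"
  shows "0 < Re (cfrac (map of_real xs @ [y])) \<and> cfrac (map of_real xs @ [y]) =
      (cfmat xs $ 1 $ 1 * y + cfmat xs $ 1 $ 2) / (cfmat xs $ 2 $ 1 * y + cfmat xs $ 2 $ 2)"
  using assms(1)
proof (induction xs)
  case Nil
  show ?case using assms(2) by (simp add: mat_def)
next
  case (Cons x xs)
  let ?N = "cfmat xs $ 1 $ 1 * y + cfmat xs $ 1 $ 2"
  let ?D = "cfmat xs $ 2 $ 1 * y + cfmat xs $ 2 $ 2"
  let ?f = "cfrac (map of_real xs @ [y])"
  have IH: "0 < Re ?f" "?f = ?N / ?D"
    using Cons by auto
  \<comment> \<open>Since division by 0 yields 0, a vanishing \<open>?N\<close> or \<open>?D\<close>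
    would contradict \<open>0 < Re ?f\<close>.\<close>
  then have "?N \<noteq> 0" "?D \<noteq> 0" by auto
  have step: "cfrac (map of_real (x # xs) @ [y]) = x + 1 / ?f"
    by (simp add: cfrac_Cons)
  have "0 \<le> Re (1 / ?f)"
    using IH(1) by (simp add: Re_divide)
  then have "0 < Re (x + 1 / ?f)"
    using Cons.prems by simp
  moreover have "x + 1 / ?f = (cfmat (x # xs) $ 1 $ 1 * y + cfmat (x # xs) $ 1 $ 2) /
      (cfmat (x # xs) $ 2 $ 1 * y + cfmat (x # xs) $ 2 $ 2)"
  proof -
    have "t + 1 / (n / d) = (t * n + d) / n" if "n \<noteq> 0" for t n d :: complex
      using that by (simp add: field_simps)
    with \<open>?N \<noteq> 0\<close> have "x + 1 / ?f = (x * ?N + ?D) / ?N"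
      unfolding IH(2) by blast
    also have "x * ?N + ?D = cfmat (x # xs) $ 1 $ 1 * y + cfmat (x # xs) $ 1 $ 2"
      by (simp add: algebra_simps)
    finally show ?thesis by simp
  qed
  ultimately show ?case unfolding step by blast
qed

text \<open>The recurrence for the last entry moves \<open>x\<close> into the matrix and leaves only
  the perturbation \<open>u\<close>, which is later \<open>- \<i>\<close> or
  \<open>\<i>\<close>.\<close>

lemma cfrac_snoc_cfmat:
  fixes u :: complex
  assumes "\<forall>x\<in>set xs. 0 < x" "0 < x" "0 \<le> Re u"
  shows "cfrac (map of_real xs @ [of_real x + u]) =
      (cfmat (xs @ [x]) $ 1 $ 1 + u * cfmat (xs @ [x]) $ 1 $ 2) /
      (cfmat (xs @ [x]) $ 2 $ 1 + u * cfmat (xs @ [x]) $ 2 $ 2)"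
  using cfrac_cfmat[of xs "of_real x + u"] assms by (simp add: algebra_simps)

lemma cfrac_cfmat_real:
  fixes y :: real
  assumes "\<forall>x\<in>set xs. 0 < x" "0 < y"
  shows "cfrac (xs @ [y]) =
      (cfmat xs $ 1 $ 1 * y + cfmat xs $ 1 $ 2) / (cfmat xs $ 2 $ 1 * y + cfmat xs $ 2 $ 2)"
    (is "_ = ?r")
proof -
  have "cfrac (map complex_of_real (xs @ [y])) = of_real ?r"
    using cfrac_cfmat[of xs "of_real y"] assms by simp
  then have "complex_of_real (cfrac (xs @ [y])) = of_real ?r"
    by (simp only: of_real_cfrac append_is_Nil_conv list.simps simp_thms)
  then show ?thesis by (simp only: of_real_eq_iff)
qed

lemma cfrac_snoc_cfmat_real:
  fixes u :: real
  assumes "\<forall>x\<in>set xs. 0 < x" "0 < x" "0 \<le> u"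
  shows "cfrac (xs @ [x + u]) =
      (cfmat (xs @ [x]) $ 1 $ 1 + u * cfmat (xs @ [x]) $ 1 $ 2) /
      (cfmat (xs @ [x]) $ 2 $ 1 + u * cfmat (xs @ [x]) $ 2 $ 2)"
  using cfrac_cfmat_real[of xs "x + u"] assms by (simp add: algebra_simps)

lemma cfrac_eq_cfmat_ratio:
  assumes "\<forall>x\<in>set xs. 0 < x" "xs \<noteq> []"
  shows "cfrac xs = cfmat xs $ 1 $ 1 / cfmat xs $ 2 $ 1"
  using assms cfrac_snoc_cfmat_real[of "butlast xs" "last xs" 0]
  by (cases xs rule: rev_cases) auto

lemma cfmat_palindrome:
  "cfmat (xs @ rev xs) $ i $ j = cfmat xs $ i $ 1 * cfmat xs $ j $ 1 + cfmat xs $ i $ 2 * cfmat xs $ j $ 2"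
  by (simp add: cfmat_append matrix_matrix_mult_def sum_2 transpose_def flip: transpose_cfmat)

section \<open>Convergence of infinite continued fractions to a prescribed limit\<close>

text \<open>Passing from \<open>s\<close> to its second tail divides the distance to the limit by the product
  of two consecutive complete quotients, once for the truncation and once for the limit;
  each of the two products is \<open>b\<^sub>n x\<^sub>n\<^sub>+\<^sub>1 + 1 \<ge> 1 + \<delta>\<^sup>2\<close>.\<close>

lemma cfrac_stake_dist:
  fixes I :: "real stream \<Rightarrow> real \<Rightarrow> bool"
  assumes step: "\<And>s x. I s x \<Longrightarrow> \<delta> \<le> shd s \<and> (\<exists>y>0. x = shd s + 1 / y \<and> I (stl s) y)"
    and "0 < \<delta>" "I s x"
  shows "\<bar>cfrac (stake (Suc n) s) - x\<bar> \<le> (1 / \<delta> + 1 / \<delta> ^ 3) * (1 / (1 + \<delta>\<^sup>2)) ^ (n div 2)"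
  using \<open>I s x\<close>
proof (induction n arbitrary: s x rule: nat_induct2)
  have ge: "\<delta> \<le> x" if "I s x" for s x
  proof -
    from step[OF that] obtain y where "0 < y" "x = shd s + 1 / y" "\<delta> \<le> shd s" by blast
    then have "0 < 1 / y" by simp
    with \<open>x = _\<close> \<open>\<delta> \<le> _\<close> show ?thesis by linarith
  qed
  have first: "\<bar>shd s - x\<bar> \<le> 1 / \<delta>" if "I s x" for s x
  proof -
    from step[OF that] obtain y where "0 < y" "x = shd s + 1 / y" "I (stl s) y" by blast
    with ge[of "stl s" y] \<open>0 < \<delta>\<close> show ?thesis by (simp add: frac_le)
  qed
  {
    \<comment> \<open>The cases 0 and 1 account for the summands \<open>1 / \<delta>\<close> and
      \<open>1 / \<delta> ^ 3\<close> of the constant.\<close>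
    case 0
    with first[OF 0] show ?case using \<open>0 < \<delta>\<close> by (simp add: add_increasing2)
  next
    case 1
    then obtain y where y: "x = shd s + 1 / y" "I (stl s) y" using step by blast
    define b where "b = shd (stl s)"
    have b: "\<delta> \<le> b" "\<delta> \<le> y" "\<bar>b - y\<bar> \<le> 1 / \<delta>"
      using step[OF y(2)] ge[OF y(2)] first[OF y(2)] by (auto simp: b_def)
    have "cfrac (stake (Suc 1) s) - x = (y - b) / (b * y)"
      using b \<open>0 < \<delta>\<close> by (simp add: y(1) b_def field_simps)
    also have "\<bar>\<dots>\<bar> = \<bar>b - y\<bar> / (b * y)"
      using b \<open>0 < \<delta>\<close> by (simp add: abs_mult abs_minus_commute)
    also have "\<dots> \<le> (1 / \<delta>) / (\<delta> * \<delta>)"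
      using b \<open>0 < \<delta>\<close> by (intro frac_le mult_mono) auto
    finally show ?case using \<open>0 < \<delta>\<close> by (simp add: power3_eq_cube add_increasing)
  next
    case (step n)
    obtain y where y: "x = shd s + 1 / y" "I (stl s) y" using assms(1) step.prems by blast
    then obtain z where z: "y = shd (stl s) + 1 / z" "I (stl (stl s)) z" using assms(1) by blast
    define b where "b = shd (stl s)"
    define f where "f = cfrac (stake (Suc n) (stl (stl s)))"
    \<comment> \<open>The relation \<open>I\<close> bounds entries and limits from below;
      truncations need an induction of their own.\<close>
    have "cfrac (stake (Suc m) t) \<ge> \<delta>" if "I t x" for m t x
      using that
    proof (induction m arbitrary: t x)
      case 0 then show ?case using assms(1) by auto
    next
      case (Suc m)
      then obtain y where "I (stl t) y" "\<delta> \<le> shd t" using assms(1) by blast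
      moreover from this Suc.IH[of "stl t" y] \<open>0 < \<delta>\<close>
      have "0 < 1 / cfrac (stake (Suc m) (stl t))" by (simp del: stake.simps)
      moreover have "cfrac (stake (Suc (Suc m)) t) = shd t + 1 / cfrac (stake (Suc m) (stl t))"
        by (subst stake.simps) (simp add: cfrac_Cons)
      ultimately show ?case by linarith
    qed
    then have f: "\<delta> \<le> f" using z(2) by (simp only: f_def)
    have b: "\<delta> \<le> b" "\<delta> \<le> z" using assms(1)[OF y(2)] ge[OF z(2)] by (auto simp: b_def)
    have eq: "cfrac (stake (Suc (n + 2)) s) = shd s + 1 / (b + 1 / f)"
      by (simp add: f_def b_def cfrac_Cons)
    have pos: "0 < b" "0 < f" "0 < z" using b f \<open>0 < \<delta>\<close> by auto
    then have "0 < b * f + 1" "0 < b * z + 1" by (simp_all add: add_pos_pos)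
    have e1: "1 / (b + 1 / f) = f / (b * f + 1)" "1 / y = z / (b * z + 1)"
      using pos by (simp_all add: z(1) b_def field_simps)
    have "cfrac (stake (Suc (n + 2)) s) - x = f / (b * f + 1) - z / (b * z + 1)"
      unfolding eq y(1) e1 by simp
    also have "\<dots> = (f - z) / ((b * f + 1) * (b * z + 1))"
      using \<open>0 < b * f + 1\<close> \<open>0 < b * z + 1\<close> by (simp add: divide_simps) (simp add: algebra_simps)
    also have "\<bar>\<dots>\<bar> = \<bar>f - z\<bar> / ((b * f + 1) * (b * z + 1))"
      using \<open>0 < b * f + 1\<close> \<open>0 < b * z + 1\<close> by (simp add: abs_mult)
    \<comment> \<open>One of the two factors suffices for a geometric rate, so the other is bounded
      below just by 1.\<close>
    also have "\<dots> \<le> \<bar>f - z\<bar> / ((1 + \<delta>\<^sup>2) * 1)"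
    proof (intro divide_left_mono mult_mono)
      show "1 + \<delta>\<^sup>2 \<le> b * f + 1"
        using mult_mono[OF b(1) f] pos \<open>0 < \<delta>\<close> by (simp add: power2_eq_square)
    qed (use pos \<open>0 < \<delta>\<close> in \<open>auto intro!: mult_pos_pos add_pos_pos add_pos_nonneg\<close>)
    also have "\<dots> = \<bar>f - z\<bar> * (1 / (1 + \<delta>\<^sup>2))" by simp
    also have "\<dots> \<le> (1 / \<delta> + 1 / \<delta> ^ 3) * (1 / (1 + \<delta>\<^sup>2)) ^ (n div 2) * (1 / (1 + \<delta>\<^sup>2))"
      using step.IH[OF z(2)] by (intro mult_right_mono) (auto simp: f_def simp del: stake.simps)
    finally show ?case by (simp add: ac_simps)
  }
qed

text \<open>\<open>I s x\<close> proposes \<open>x\<close> as the value of \<open>s\<close> by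
  unfolding alone: removing the first entry leaves a related pair. This presupposes no convergence;
  the uniform bound \<open>\<delta>\<close> then forces it.\<close>

lemma cfrac_stake_tendsto:
  fixes I :: "real stream \<Rightarrow> real \<Rightarrow> bool"
  assumes "\<And>s x. I s x \<Longrightarrow> \<delta> \<le> shd s \<and> (\<exists>y>0. x = shd s + 1 / y \<and> I (stl s) y)"
    and "0 < \<delta>" "I s x"
  shows "has_cfrac s x"
proof -
  let ?C = "1 / \<delta> + 1 / \<delta> ^ 3" and ?r = "1 / (1 + \<delta>\<^sup>2)"
  have "filterlim (\<lambda>n::nat. n div 2) sequentially sequentially"
    unfolding filterlim_at_top
  proof
    show "\<forall>\<^sub>F n in sequentially. m \<le> n div 2" for m :: nat
      using eventually_ge_at_top[of "2 * m"] by eventually_elim auto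
  qed
  moreover have "(\<lambda>n. ?r ^ n) \<longlonglongrightarrow> 0"
    using \<open>0 < \<delta>\<close> by (intro LIMSEQ_realpow_zero) (auto simp: divide_less_eq add_pos_pos)
  ultimately have "(\<lambda>n. ?r ^ (n div 2)) \<longlonglongrightarrow> 0"
    by (rule filterlim_compose[rotated])
  then have "(\<lambda>n. ?C * ?r ^ (n div 2)) \<longlonglongrightarrow> 0"
    by (rule tendsto_mult_right_zero)
  then have "(\<lambda>n. cfrac (stake (Suc n) s) - x) \<longlonglongrightarrow> 0"
    by (rule Lim_null_comparison[rotated])
       (use cfrac_stake_dist[of I \<delta> s x] assms in \<open>auto simp del: stake.simps\<close>)
  then show ?thesis
    unfolding has_cfrac_def by (rule LIM_zero_cancel)
qed

text \<open>A positive \<open>x\<close> reproduced by one period serves as the complete quotient at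
  each period boundary, so the limit is known in advance and only an invariant has to be
  supplied.\<close>

lemma has_cfrac_shift_cycle:
  fixes x :: real
  assumes "xs \<noteq> []" and pos: "\<forall>y\<in>set (ps @ xs). 0 < y" "0 < x" and fix_x: "x = cfrac (xs @ [x])"
  shows "has_cfrac (ps @- cycle xs) (cfrac (ps @ [x]))"
proof -
  \<comment> \<open>\<open>ys\<close> is what remains unread before the next period. Once it is
    empty, \<open>fix_x\<close> allows replacing it by \<open>xs\<close>, so the relation survives
    passing to the tail.\<close>
  define I where "I s y \<longleftrightarrow>
    (\<exists>ys. set ys \<subseteq> set (ps @ xs) \<and> s = ys @- cycle xs \<and> y = cfrac (ys @ [x]))" for s y
  let ?\<delta> = "Min (set (ps @ xs))"
  have tail: "?\<delta> \<le> shd s \<and> (\<exists>y>0. t = shd s + 1 / y \<and> I (stl s) y)"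
    if "set (z # zs) \<subseteq> set (ps @ xs)" "s = (z # zs) @- cycle xs" "t = cfrac ((z # zs) @ [x])"
    for s t z zs
  proof -
    have "?\<delta> \<le> z" using that by (intro Min_le) auto
    moreover have "0 < cfrac (zs @ [x])" using that pos by (intro cfrac_pos) auto
    moreover have "I (stl s) (cfrac (zs @ [x]))" using that by (auto simp: I_def)
    ultimately show ?thesis using that by (auto simp: cfrac_Cons)
  qed
  show ?thesis
  proof (rule cfrac_stake_tendsto[of I ?\<delta>])
    fix s y assume "I s y"
    then obtain ys where ys: "set ys \<subseteq> set (ps @ xs)" "s = ys @- cycle xs" "y = cfrac (ys @ [x])"
      by (auto simp: I_def)
    show "?\<delta> \<le> shd s \<and> (\<exists>z>0. y = shd s + 1 / z \<and> I (stl s) z)"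
    proof (cases ys)
      case Nil
      then have "s = xs @- cycle xs" "y = cfrac (xs @ [x])"
        using ys \<open>xs \<noteq> []\<close> fix_x by (auto simp flip: cycle_decomp)
      then show ?thesis using tail[of "hd xs" "tl xs" s y] \<open>xs \<noteq> []\<close> by simp
    next
      case (Cons z zs)
      then show ?thesis using ys tail by auto
    qed
  next
    show "0 < ?\<delta>" using pos \<open>xs \<noteq> []\<close> by (subst Min_gr_iff) auto
  next
    show "I (ps @- cycle xs) (cfrac (ps @ [x]))" by (auto simp: I_def)
  qed
qed

lemma has_cfrac_of_real:
  assumes "has_cfrac s x"
  shows "has_cfrac (smap complex_of_real s) (of_real x)"
  using tendsto_of_real[OF assms[unfolded has_cfrac_def], where 'a=complex]
  by (simp add: has_cfrac_def flip: of_real_cfrac del: stake.simps)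

section \<open>Arctangent and arccotangent in the right half plane\<close>

text \<open>\<open>Arctan z\<close> is a multiple of \<open>Ln q\<close> for the Cayley quotient
  \<open>q\<close>, which lies in the lower half plane. Off its cut, \<open>Ln\<close> commutes with
  conjugation and turns inversion into negation.\<close>

lemma
  assumes "0 < Re z"
  shows Arctan_cnj: "Arctan (cnj z) = cnj (Arctan z)"
    and Re_Arctan_pos: "0 < Re (Arctan z)"
proof -
  define q where "q = (1 - \<i> * z) / (1 + \<i> * z)"
  have "1 + \<i> * z \<noteq> 0"
    using assms by (auto simp: complex_eq_iff)
  then have "0 < (Re (1 + \<i> * z))\<^sup>2 + (Im (1 + \<i> * z))\<^sup>2"
    by (simp add: complex_neq_0)
  moreover have "Im q = - 2 * Re z / ((Re (1 + \<i> * z))\<^sup>2 + (Im (1 + \<i> * z))\<^sup>2)"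
    unfolding q_def Im_divide by (simp add: algebra_simps)
  ultimately have "Im q < 0"
    using assms by (simp add: divide_neg_pos)
  then have q: "q \<notin> \<real>\<^sub>\<le>\<^sub>0" "cnj q \<notin> \<real>\<^sub>\<le>\<^sub>0"
    by (auto simp: complex_nonpos_Reals_iff)
  have "0 < Im (Ln (cnj q))"
    using Im_Ln_pos_lt_imp[of "cnj q"] \<open>Im q < 0\<close> by simp
  then show "0 < Re (Arctan z)"
    by (simp add: Arctan_def flip: q_def cnj_Ln[OF q(1)])
  \<comment> \<open>Conjugating \<open>z\<close> turns \<open>q\<close> into the inverse of
    \<open>cnj q\<close>.\<close>
  have "Arctan (cnj z) = \<i> / 2 * Ln (inverse (cnj q))"
    by (simp add: Arctan_def q_def)
  also have "\<dots> = cnj (\<i> / 2 * Ln q)"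
    by (simp add: Ln_inverse[OF q(2)] cnj_Ln[OF q(1)])
  finally show "Arctan (cnj z) = cnj (Arctan z)"
    by (simp add: Arctan_def q_def)
qed

text \<open>The conjugate imaginary parts cancel, so half the sum is a real \<open>t\<close>
  strictly between 0 and \<open>pi / 2\<close>, and \<open>x = cot t\<close> is positive. The
  equation compares the addition formula for \<open>cot (Arccot z + Arccot (cnj z))\<close> with the
  double angle formula for \<open>cot (2 * t)\<close>, denominators cleared.\<close>

lemma half_Arccot_sum_cnj:
  assumes "0 < Re z"
  obtains x :: real where "0 < x" "cot ((Arccot z + Arccot (cnj z)) / 2) = of_real x"
    "(of_real x ^ 2 - 1) * (z + cnj z) = 2 * of_real x * (z * cnj z - 1)"
proof -
  define t where "t = pi / 2 - Re (Arctan z)"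
  have t: "Arccot z + Arccot (cnj z) = of_real (2 * t)"
    by (simp add: complex_eq_iff t_def Arccot_def Arctan_cnj[OF assms])
  have "0 < t" "t < pi / 2"
    using Re_Arctan_pos[OF assms] Re_Arctan_bounds[of z] assms by (auto simp: t_def)
  then have "0 < cot t" by (rule cot_gt_zero)
  have "0 < sin t" using \<open>0 < t\<close> \<open>t < pi / 2\<close> by (intro sin_gt_zero) auto
  let ?x = "complex_of_real (cot t)" and ?s = "complex_of_real (sin t)"
  have cs: "cos (Arccot w) = w * sin (Arccot w) \<and> sin (Arccot w) \<noteq> 0" if "0 < Re w" for w
  proof -
    have "cot (Arccot w) = w" using that by (intro cot_Arccot) auto
    moreover have "w \<noteq> 0" using that by auto
    ultimately show ?thesis by (auto simp: cot_def divide_eq_eq split: if_splits)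
  qed
  define S where "S = sin (Arccot z) * sin (Arccot (cnj z))"
  have "S \<noteq> 0" using cs[of z] cs[of "cnj z"] assms by (auto simp: S_def)
  have "cos (Arccot z + Arccot (cnj z)) = (z * cnj z - 1) * S"
    using cs[of z] cs[of "cnj z"] assms by (simp add: cos_add S_def algebra_simps)
  moreover have "sin (Arccot z + Arccot (cnj z)) = (z + cnj z) * S"
    using cs[of z] cs[of "cnj z"] assms by (simp add: sin_add S_def algebra_simps)
  moreover have c: "cos t = cot t * sin t"
    using \<open>0 < sin t\<close> by (simp add: cot_def)
  have "cos (2 * t) = ((cot t)\<^sup>2 - 1) * (sin t)\<^sup>2"
    unfolding cos_double c by (simp add: algebra_simps power2_eq_square)
  then have "cos (complex_of_real (2 * t)) = (?x\<^sup>2 - 1) * ?s\<^sup>2"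
    unfolding cos_of_real by (simp only: of_real_mult of_real_diff of_real_power of_real_1)
  moreover have "sin (2 * t) = 2 * cot t * (sin t)\<^sup>2"
    unfolding sin_double c by (simp add: algebra_simps power2_eq_square)
  then have "sin (complex_of_real (2 * t)) = 2 * ?x * ?s\<^sup>2"
    unfolding sin_of_real by (simp only: of_real_mult of_real_power of_real_numeral)
  ultimately have C: "(?x\<^sup>2 - 1) * ?s\<^sup>2 = (z * cnj z - 1) * S"
    and D: "2 * ?x * ?s\<^sup>2 = (z + cnj z) * S"
    by (simp_all only: t)
  \<comment> \<open>Cross-multiplying \<open>C\<close> and \<open>D\<close> leaves the nonzero
    common factor \<open>?s\<^sup>2 * S\<close> to cancel.\<close>
  have "((?x\<^sup>2 - 1) * (z + cnj z)) * (?s\<^sup>2 * S) = ((?x\<^sup>2 - 1) * ?s\<^sup>2) * ((z + cnj z) * S)"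
    by (simp only: ac_simps)
  also have "\<dots> = (2 * ?x * (z * cnj z - 1)) * (?s\<^sup>2 * S)"
    unfolding C D[symmetric] by (simp only: ac_simps)
  finally have "(?x\<^sup>2 - 1) * (z + cnj z) = 2 * ?x * (z * cnj z - 1)"
    using \<open>S \<noteq> 0\<close> \<open>0 < sin t\<close> by simp
  moreover have "cot ((Arccot z + Arccot (cnj z)) / 2) = ?x"
    unfolding t by (simp add: cot_of_real)
  ultimately show ?thesis using that \<open>0 < cot t\<close> by blast
qed

section \<open>The arithmetic, geometric, harmonic and cotangent means\<close>

theorem theorem1p2:
  fixes k :: nat and a :: "nat \<Rightarrow> real"
  assumes "\<And>j. j \<le> k + 1 \<Longrightarrow> 0 < a j"
  shows "let c = (\<lambda>j. complex_of_real (a j));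
             z = cfrac (map c [0..<k+1] @ [c (k+1) - \<i>]);
             w = cfrac (map c [0..<k+1] @ [c (k+1) + \<i>])
         in (z + w) / 2 = cfrac (map c [0..<k+2] @ rev (map c [1..<k+2]))
          \<and> has_cfrac ([c 0] @- cycle (map c [1..<k+2] @ rev (map c [1..<k+2]) @ [2 * c 0]))
              (csqrt (z * w))
          \<and> 2 / (1 / z + 1 / w) = cfrac (map c [0..<k+2] @ rev (map c [0..<k+2]))
          \<and> has_cfrac (cycle (map c [0..<k+2] @ rev (map c [0..<k+2])))
              (cot ((Arccot z + Arccot w) / 2))"
proof -
  define xs where "xs = map a [0..<k+1]"
  define ys where "ys = map a [1..<k+2]"
  define L where "L = map a [0..<k+2]"
  have L: "L = a 0 # ys" "L = xs @ [a (k + 1)]"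
    using arg_cong[OF upt_conv_Cons[of 0 "k + 2"], of "map a"] by (simp add: L_def ys_def)
      (simp add: L_def xs_def)
  have pos: "\<forall>x\<in>set L. 0 < x"
    using assms by (auto simp: L_def)
  define P P' Q Q' where "P = cfmat L $ 1 $ 1" "P' = cfmat L $ 1 $ 2" "Q = cfmat L $ 2 $ 1" "Q' = cfmat L $ 2 $ 2"
  note defs = this
  define N R S where "N = P\<^sup>2 + P'\<^sup>2" "R = P * Q + P' * Q'" "S = Q\<^sup>2 + Q'\<^sup>2"
  note NRS = this
  have "0 < P" "0 < Q" "0 \<le> P'" "0 \<le> Q'"
    using cfmat_nonneg[OF pos] cfmat_pos[OF pos] L by (simp_all add: defs)
  then have pos': "0 < N" "0 < R" "0 < S"
    by (simp_all add: NRS add_pos_nonneg)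
  have pal: "cfmat (L @ rev L) $ 1 $ 1 = N" "cfmat (L @ rev L) $ 1 $ 2 = R"
    "cfmat (L @ rev L) $ 2 $ 1 = R" "cfmat (L @ rev L) $ 2 $ 2 = S"
    unfolding cfmat_palindrome by (simp_all add: NRS defs power2_eq_square mult.commute)
  \<comment> \<open>Cutting off the final \<open>a 0\<close> exposes the second column of the
    palindrome's matrix: the shorter list has the value \<open>R / S\<close>.\<close>
  have LL: "L @ rev L = (L @ rev ys) @ [a 0]"
    by (simp add: L(1))

  define z w where "z = cfrac (map of_real xs @ [of_real (a (k+1)) - \<i>])"
    "w = cfrac (map of_real xs @ [of_real (a (k+1)) + \<i>])"
  note zw_def = this
  have zw: "z = (of_real P - \<i> * of_real P') / (of_real Q - \<i> * of_real Q')"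
    "w = (of_real P + \<i> * of_real P') / (of_real Q + \<i> * of_real Q')"
    using cfrac_snoc_cfmat[of xs "a (k + 1)" "- \<i>"] cfrac_snoc_cfmat[of xs "a (k + 1)" "\<i>"] pos
    by (simp_all add: zw_def L(2) defs)
  then have w: "w = cnj z" by simp
  have "0 < Re z"
    using cfrac_cfmat[of xs "of_real (a (k + 1)) - \<i>", THEN conjunct1] pos by (simp add: zw_def L(2))
  then have "z \<noteq> 0" "w \<noteq> 0" by (auto simp: w)
  have nz: "of_real Q - \<i> * of_real Q' \<noteq> 0" "of_real Q + \<i> * of_real Q' \<noteq> 0"
    using \<open>0 < Q\<close> by (auto simp: complex_eq_iff)
  \<comment> \<open>\<open>S\<close> is the squared modulus of the denominator of \<open>z\<close>,
    hence a common denominator for product and sum.\<close>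
  have S: "of_real S = (of_real Q - \<i> * of_real Q') * (of_real Q + \<i> * of_real Q')"
    by (simp add: NRS algebra_simps power2_eq_square)
  have prod: "z * w = of_real (N / S)"
    unfolding zw of_real_divide S by (simp add: NRS algebra_simps power2_eq_square)
  have sum: "z + w = of_real (2 * R / S)"
    unfolding zw of_real_divide S add_frac_eq[OF nz] by (simp add: NRS algebra_simps)

  have "cfrac (L @ rev ys) = R / S"
    using cfrac_eq_cfmat_ratio[of "L @ rev ys"] pos pal(2,4) unfolding LL cfmat_snoc_nth by (auto simp: L(1))
  then have 1: "(z + w) / 2 = cfrac (map of_real (L @ rev ys))"
    by (subst of_real_cfrac) (simp_all add: sum L(1))

  have "cfrac (L @ rev L) = N / R"
    using cfrac_eq_cfmat_ratio[of "L @ rev L"] pos pal by (auto simp: L(1))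
  moreover have "2 / (1 / z + 1 / w) = 2 * (z * w) / (z + w)"
    using \<open>z \<noteq> 0\<close> \<open>w \<noteq> 0\<close> by (simp add: add_frac_eq add.commute)
  then have "2 / (1 / z + 1 / w) = of_real (N / R)"
    unfolding prod sum using pos' by simp
  ultimately have 3: "2 / (1 / z + 1 / w) = cfrac (map of_real (L @ rev L))"
    by (subst of_real_cfrac) (simp_all add: L(1))

  have 2: "has_cfrac (map of_real [a 0] @- cycle (map of_real (ys @ rev ys @ [2 * a 0]))) (csqrt (z * w))"
  proof -
    define x where "x = sqrt (N / S)"
    have "0 < x" "x * x = N / S" using pos' by (simp_all add: x_def)
    \<comment> \<open>\<open>y\<close> is the complete quotient after \<open>a 0\<close>. Once
      \<open>x = a 0 + 1 / y\<close> is known, the closing entry \<open>2 * a 0\<close> followed by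
      \<open>y\<close> is worth \<open>a 0 + x\<close>, so one period reproduces
      \<open>y\<close>.\<close>
    define y where "y = cfrac ((ys @ rev ys) @ [a 0 + x])"
    have "0 < y"
      unfolding y_def using pos \<open>0 < x\<close> by (intro cfrac_pos) (auto simp: L(1))
    have "cfrac ((L @ rev ys) @ [a 0 + x]) = (N + x * R) / (R + x * S)"
      using cfrac_snoc_cfmat_real[of "L @ rev ys" "a 0" x] pos \<open>0 < x\<close>
      unfolding LL[symmetric] pal by (auto simp: L(1))
    also have "N + x * R = x * (R + x * S)"
      using \<open>x * x = N / S\<close> pos' by (simp add: field_simps)
    also have "x * (R + x * S) / (R + x * S) = x"
      using pos' \<open>0 < x\<close> add_pos_pos[of R "x * S"] by simp
    finally have x: "a 0 + 1 / y = x"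
      by (simp add: L(1) y_def cfrac_Cons)
    have "cfrac ((ys @ rev ys @ [2 * a 0]) @ [y]) = cfrac ((ys @ rev ys) @ [cfrac [2 * a 0, y]])"
      using cfrac_append_append[of "[2 * a 0, y]" "ys @ rev ys"] by simp
    also have "cfrac [2 * a 0, y] = a 0 + x"
      by (simp flip: x)
    finally have "has_cfrac ([a 0] @- cycle (ys @ rev ys @ [2 * a 0])) (cfrac ([a 0] @ [y]))"
      using pos \<open>0 < y\<close> by (intro has_cfrac_shift_cycle) (auto simp: L(1) y_def)
    from has_cfrac_of_real[OF this] show ?thesis
      using pos' by (simp add: x smap_cycle prod csqrt_of_real x_def)
  qed

  have 4: "has_cfrac (cycle (map of_real (L @ rev L))) (cot ((Arccot z + Arccot w) / 2))"
  proof -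
    obtain x where "0 < x" and cot: "cot ((Arccot z + Arccot w) / 2) = of_real x"
      and "(of_real x ^ 2 - 1) * (z + w) = 2 * of_real x * (z * w - 1)"
      using half_Arccot_sum_cnj[OF \<open>0 < Re z\<close>] unfolding w by blast
    then have "complex_of_real ((x\<^sup>2 - 1) * (2 * R / S)) = of_real (2 * x * (N / S - 1))"
      unfolding prod sum by simp
    then have "(x\<^sup>2 - 1) * (2 * R / S) = 2 * x * (N / S - 1)"
      by (simp only: of_real_eq_iff)
    then have "(x\<^sup>2 - 1) * R = x * (N - S)"
      using pos' by (simp add: field_simps)
    \<comment> \<open>Rearranged, the quadratic equation says that \<open>x\<close> is fixed by the
      Moebius map with matrix \<open>((N, R), (R, S))\<close>.\<close>
    then have "N * x + R = x * (R * x + S)"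
      by (simp add: algebra_simps power2_eq_square)
    moreover have "cfrac ((L @ rev L) @ [x]) = (N * x + R) / (R * x + S)"
      using cfrac_cfmat_real[of "L @ rev L" x] pos \<open>0 < x\<close> unfolding pal by auto
    ultimately have "x = cfrac ((L @ rev L) @ [x])"
      using pos' \<open>0 < x\<close> add_pos_pos[of "R * x" S] by simp
    then have "has_cfrac ([] @- cycle (L @ rev L)) (cfrac ([] @ [x]))"
      using pos \<open>0 < x\<close> by (intro has_cfrac_shift_cycle) (auto simp: L(1))
    from has_cfrac_of_real[OF this] show ?thesis
      by (simp add: smap_cycle cot L(1))
  qed

  show ?thesis
    using 1 2 3 4 unfolding Let_def zw_def xs_def ys_def L_def
    by (simp add: rev_map comp_def del: upt_Suc)
qed

end
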